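(* Let $\beta$ denote the arrow pattern $(12;1\to2)$, let $\mathcal{M}_n$ be the set of Motzkin paths of length $n$, and let $\mathfrak{S}_n(321,\beta)$ be the set of permutations in $\mathfrak{S}_n$ that avoid both the classical pattern $321$ and the arrow pattern $\beta$. For every $n\ge1$ there exists a bijection $\psi:\mathcal{M}_n\to\mathfrak{S}_n(321,\beta)$ such that for every $w\in\mathcal{M}_n$, $$\mathrm{nu}(w)=\mathsf{des}(\psi(w)),$$ where $\mathrm{nu}(w)$ is the number of up steps of $w$ and $\mathsf{des}(\sigma)=|\{i\in[n-1]:\sigma_i>\sigma_{i+1}\}|$ is the number of descents of $\sigma\in\mathfrak{S}_n$. In particular, for $n\ge2$, $|\mathfrak{S}_n(321,\beta)|=M_n$, where $M_n$ is the $n$-th Motzkin number.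
   Context: $\mathfrak{S}_n$ is the set of permutations of $[n]=\{1,\dots,n\}$, written in one-line notation $\sigma=\sigma_1\cdots\sigma_n$ with $\sigma_i=\sigma(i)$. A permutation $\sigma\in\mathfrak{S}_n$ contains the classical pattern $\pi\in\mathfrak{S}_m$ if there are $1\le i_1<\cdots<i_m\le n$ such that $\sigma_{i_1}\cdots\sigma_{i_m}$ is order-isomorphic to $\pi$; otherwise it avoids $\pi$. Standard cycle notation: every cycle (including fixed points) is written as $(a\ \sigma(a)\ \sigma^2(a)\cdots)$ beginning with its maximal element $a$, and the cycles are listed from left to right in increasing order of their maximal elements. The bijection $\Phi:\mathfrak{S}_n\to\mathfrak{S}_n$ sends $\sigma$ to the permutation whose one-line notation is obtained by erasing the parentheses in the standard cycle notation of $\sigma$. For $\sigma\in\mathfrak{S}_n$ write $\hat\sigma=\Phi^{-1}(\sigma)$. An arrow pattern of size $k$ is a pair $(\nu;H)$ with $\nu=a_1\ldots a_m$ a string of positive integers and $H=\{b_i\to c_i:1\le i\le h\}$ a (possibly empty) set of arrows, such that the distinct integers appearing in $\nu$ or $H$ form $[k]$. A permutation $\sigma\in\mathfrak{S}_n$ contains $(\nu;H)$ if there is a subset $X=\{x_1<\cdots<x_k\}\subseteq[n]$ such that (1) $\sigma_{t_1}\cdots\sigma_{t_m}=x_{a_1}\cdots x_{a_m}$ for some indices $t_1<\cdots<t_m$, and (2) $\hat\sigma(x_{b_i})=x_{c_i}$ for all $1\le i\le h$; otherwise $\sigma$ avoids it. In particular, $\sigma$ contains $\beta=(12;1\to2)$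 iff there exist $x_1<x_2$ in $[n]$ such that $x_1$ appears to the left of $x_2$ in the one-line notation of $\sigma$ and $\hat\sigma(x_1)=x_2$. A Motzkin path of length $n$ is a lattice path from $(0,0)$ to $(n,0)$ that never falls below the $x$-axis, consisting of up steps $\mathrm{U}=(1,1)$, down steps $\mathrm{D}=(1,-1)$ and level steps $\mathrm{L}=(1,0)$. The Motzkin number $M_n$ is the number of Motzkin paths of length $n$ (OEIS A001006). *)

theory Defs
  imports "HOL-Combinatorics.Combinatorics" "HOL-Library.Sublist"
begin

section \<open>Permutations of \<open>[n]\<close> and one-line notation\<close>

text \<open>A permutation of \<open>[n]\<close> is a function \<open>\<sigma> :: nat \<Rightarrow> nat\<close> with \<open>\<sigma> permutes {1..n}\<close>, so it is the
  identity outside \<open>{1..n}\<close>.  Hence a set of such functions has the same cardinality as the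
  corresponding set of one-line words.\<close>

definition perms :: "nat \<Rightarrow> (nat \<Rightarrow> nat) set" where
  "perms n = {\<sigma>. \<sigma> permutes {1..n}}"

definition one_line :: "nat \<Rightarrow> (nat \<Rightarrow> nat) \<Rightarrow> nat list" where
  "one_line n \<sigma> = map \<sigma> [1..<Suc n]"

text \<open>List positions start at 0, whereas permutations act on \<open>1, \<dots>, n\<close>.\<close>

definition perm_of_word :: "nat list \<Rightarrow> nat \<Rightarrow> nat" where
  "perm_of_word w = (\<lambda>i. if i \<in> {1..length w} then w ! (i - 1) else i)"

definition des :: "nat \<Rightarrow> (nat \<Rightarrow> nat) \<Rightarrow> nat" where
  "des n \<sigma> = card {i \<in> {1..<n}. \<sigma> i > \<sigma> (i + 1)}"

section \<open>Classical patterns\<close>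

definition order_isomorphic :: "nat list \<Rightarrow> nat list \<Rightarrow> bool" where
  "order_isomorphic u v \<longleftrightarrow>
     length u = length v \<and> (\<forall>i<length u. \<forall>j<length u. u ! i < u ! j \<longleftrightarrow> v ! i < v ! j)"

text \<open>The pattern \<open>\<pi>\<close> is given by its one-line word.\<close>

definition contains_classical :: "nat \<Rightarrow> (nat \<Rightarrow> nat) \<Rightarrow> nat list \<Rightarrow> bool" where
  "contains_classical n \<sigma> \<pi> \<longleftrightarrow> (\<exists>u. subseq u (one_line n \<sigma>) \<and> order_isomorphic u \<pi>)"

section \<open>Standard cycle notation and the bijection \<open>\<Phi>\<close>\<close>

text \<open>The list \<open>support \<sigma> a\<close> of the library is the cycle \<open>[a, \<sigma> a, \<sigma> (\<sigma> a), \<dots>]\<close> started at \<open>a\<close>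
  (and \<open>[a]\<close> if \<open>a\<close> is a fixed point).\<close>

definition cycle_maxima :: "nat \<Rightarrow> (nat \<Rightarrow> nat) \<Rightarrow> nat set" where
  "cycle_maxima n \<sigma> = {a \<in> {1..n}. a = Max (set (support \<sigma> a))}"

definition standard_cycles :: "nat \<Rightarrow> (nat \<Rightarrow> nat) \<Rightarrow> nat list list" where
  "standard_cycles n \<sigma> = map (support \<sigma>) (sorted_list_of_set (cycle_maxima n \<sigma>))"

definition Phi :: "nat \<Rightarrow> (nat \<Rightarrow> nat) \<Rightarrow> nat \<Rightarrow> nat" where
  "Phi n \<sigma> = perm_of_word (concat (standard_cycles n \<sigma>))"

text \<open>The permutation \<open>\<sigma>\<close> with a hat, that is, the preimage of \<open>\<sigma>\<close> under the bijection
  \<open>\<Phi>\<close> of the permutations of \<open>[n]\<close>.\<close>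

definition hat :: "nat \<Rightarrow> (nat \<Rightarrow> nat) \<Rightarrow> nat \<Rightarrow> nat" where
  "hat n \<sigma> = inv_into (perms n) (Phi n) \<sigma>"

section \<open>Arrow patterns\<close>

text \<open>An arrow pattern \<open>(\<nu>; H)\<close> is a string together with a set of arrows, the arrow \<open>b \<rightarrow> c\<close> being
  the pair \<open>(b, c)\<close>.\<close>

type_synonym arrow_pattern = "nat list \<times> (nat \<times> nat) set"

definition arrow_letters :: "arrow_pattern \<Rightarrow> nat set" where
  "arrow_letters p = set (fst p) \<union> fst ` snd p \<union> snd ` snd p"

definition arrow_size :: "arrow_pattern \<Rightarrow> nat" where
  "arrow_size p = card (arrow_letters p)"

definition is_arrow_pattern :: "arrow_pattern \<Rightarrow> bool" where
  "is_arrow_pattern p \<longleftrightarrow> finite (arrow_letters p) \<and> arrow_letters p = {1..arrow_size p}"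

text \<open>The subset \<open>X = {x\<^sub>1 < \<dots> < x\<^sub>k}\<close> of \<open>[n]\<close> is represented by its increasing
  enumeration \<open>x\<close>.\<close>

definition contains_arrow :: "nat \<Rightarrow> (nat \<Rightarrow> nat) \<Rightarrow> arrow_pattern \<Rightarrow> bool" where
  "contains_arrow n \<sigma> p \<longleftrightarrow>
     (\<exists>x :: nat \<Rightarrow> nat. strict_mono_on {1..arrow_size p} x \<and> x ` {1..arrow_size p} \<subseteq> {1..n} \<and>
        subseq (map x (fst p)) (one_line n \<sigma>) \<and>
        (\<forall>(b, c) \<in> snd p. hat n \<sigma> (x b) = x c))"

definition beta :: arrow_pattern where
  "beta = ([1, 2], {(1, 2)})"

lemma arrow_letters_beta: "arrow_letters beta = {1..2}"
  unfolding arrow_letters_def beta_def by auto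

lemma arrow_size_beta: "arrow_size beta = 2"
  by (simp add: arrow_size_def arrow_letters_beta)

lemma is_arrow_pattern_beta: "is_arrow_pattern beta"
  by (simp add: is_arrow_pattern_def arrow_size_beta arrow_letters_beta)

lemma contains_arrow_beta_iff:
  "contains_arrow n \<sigma> beta \<longleftrightarrow>
     (\<exists>x1\<in>{1..n}. \<exists>x2\<in>{1..n}. x1 < x2 \<and> subseq [x1, x2] (one_line n \<sigma>) \<and> hat n \<sigma> x1 = x2)"
  (is "?L \<longleftrightarrow> ?R")
proof
  assume ?L
  then obtain x :: "nat \<Rightarrow> nat" where x: "strict_mono_on {1..2} x" "x ` {1..2} \<subseteq> {1..n}"
    "subseq [x 1, x 2] (one_line n \<sigma>)" "hat n \<sigma> (x 1) = x 2"
    unfolding contains_arrow_def arrow_size_beta by (auto simp: beta_def)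
  have "x 1 < x 2"
    by (rule strict_mono_onD[OF x(1)]) auto
  moreover have "x 1 \<in> {1..n}" "x 2 \<in> {1..n}"
    by (rule subsetD[OF x(2)], rule imageI, simp)+
  ultimately show ?R
    using x(3,4) by blast
next
  assume ?R
  then obtain x1 x2 where x: "x1 \<in> {1..n}" "x2 \<in> {1..n}" "x1 < x2"
    "subseq [x1, x2] (one_line n \<sigma>)" "hat n \<sigma> x1 = x2" by blast
  have s: "{1..2} = {1, 2 :: nat}" by auto
  show ?L
    unfolding contains_arrow_def arrow_size_beta s
    by (rule exI[of _ "\<lambda>i. if i = 1 then x1 else x2"])
      (use x in \<open>auto simp: beta_def strict_mono_on_def\<close>)
qed

definition Av_321_beta :: "nat \<Rightarrow> (nat \<Rightarrow> nat) set" where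
  "Av_321_beta n =
     {\<sigma> \<in> perms n. \<not> contains_classical n \<sigma> [3, 2, 1] \<and> \<not> contains_arrow n \<sigma> beta}"

section \<open>Motzkin paths\<close>

datatype step = Up | Down | Level

primrec step_height :: "step \<Rightarrow> int" where
  "step_height Up = 1"
| "step_height Down = - 1"
| "step_height Level = 0"

definition path_height :: "step list \<Rightarrow> int" where
  "path_height w = (\<Sum>s\<leftarrow>w. step_height s)"

definition motzkin_paths :: "nat \<Rightarrow> step list set" where
  "motzkin_paths n =
     {w. length w = n \<and> (\<forall>k\<le>n. path_height (take k w) \<ge> 0) \<and> path_height w = 0}"

definition motzkin_number :: "nat \<Rightarrow> nat" where
  "motzkin_number n = card (motzkin_paths n)"

definition nu :: "step list \<Rightarrow> nat" where
  "nu w = count_list w Up"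

end

theory Submission
  imports Defs
begin

text \<open>
  Read the standard cycle notation of a permutation without its parentheses. Every cycle starts
  with its maximum and the maxima increase, so the cycles are exactly the blocks into which the
  one-line word splits just before each of its left-to-right maxima. Hence \<open>hat\<close> sends a letter of
  the word to the next letter, unless the letter ends its block, in which case it goes back to
  the last left-to-right maximum (\<open>hat_successor\<close>). An occurrence of the arrow pattern is
  therefore an ascent inside a block: two adjacent letters \<open>p < q\<close> with a letter larger than \<open>q\<close>
  somewhere before them. So \<open>beta\<close> is contained if and only if the vincular pattern 3-12 is, the
  last two letters being adjacent (\<open>contains_beta_iff\<close>).

  If 3-12 is avoided, every block decreases; if 321 is avoided as well, a block has at most two
  letters, and the letters that are not left-to-right maxima increase. Conversely these
  properties of the blocks exclude both patterns (\<open>fifo_words_eq\<close>). The permutations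
  in question thus have words made of blocks \<open>[x]\<close> and \<open>[x, y]\<close> with \<open>y < x\<close>, where the first
  letters increase from block to block and so do the second letters.

  Such a word is the output of a queue that processes the values \<open>1, 2, \<dots>, n\<close> in this order. A
  value that occurs as a second letter enters the queue, a value that forms a block of its own is
  written at once, and a value \<open>x\<close> that starts a block of two letters is written together with
  the front of the queue; the front is the right partner because the second letters come out in
  increasing order. Recording the three actions as up, level and down steps, with the length of
  the queue as the height, gives the bijection with Motzkin paths (\<open>bij_betw_queue_word\<close>).
  Descents occur exactly inside the blocks of two letters, so their number is that of the down
  steps, which is that of the up steps.
\<close>

section \<open>Motzkin paths and queue words\<close>

text \<open>
  Paths from height \<open>h\<close> down to the axis that never go below it. The starting height is a parameter so
  that induction over the steps is possible.
\<close>

primrec motzkin_from :: "nat \<Rightarrow> step list \<Rightarrow> bool" where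
  "motzkin_from h [] \<longleftrightarrow> h = 0"
| "motzkin_from h (s # w) \<longleftrightarrow>
     (case s of Up \<Rightarrow> motzkin_from (Suc h) w
      | Level \<Rightarrow> motzkin_from h w
      | Down \<Rightarrow> 0 < h \<and> motzkin_from (h - 1) w)"

lemma path_height_simps [simp]:
  "path_height [] = 0" "path_height (s # w) = step_height s + path_height w"
  by (simp_all add: path_height_def)

lemma all_le_Suc_iff: "(\<forall>k\<le>Suc n. P k) \<longleftrightarrow> P 0 \<and> (\<forall>k\<le>n. P (Suc k))"
  by (metis Suc_le_mono not0_implies_Suc zero_le)

lemma motzkin_from_iff:
  "motzkin_from h w \<longleftrightarrow>
     (\<forall>k\<le>length w. 0 \<le> int h + path_height (take k w)) \<and> int h + path_height w = 0"
proof (induction w arbitrary: h)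
  case Nil
  then show ?case by simp
next
  case (Cons s w)
  show ?case
  proof (cases s)
    case Down
    show ?thesis
    proof (cases h)
      case 0
      then have "\<not> 0 \<le> int h + path_height (take (Suc 0) (s # w))"
        using Down by simp
      moreover have "Suc 0 \<le> length (s # w)" by simp
      ultimately show ?thesis using 0 Down by (auto simp del: take_Suc_Cons)
    qed (use Down in \<open>simp add: Cons.IH all_le_Suc_iff algebra_simps\<close>)
  qed (simp_all add: Cons.IH all_le_Suc_iff algebra_simps)
qed

lemma motzkin_paths_eq: "motzkin_paths n = {w. length w = n \<and> motzkin_from 0 w}"
  by (auto simp: motzkin_paths_def motzkin_from_iff)

lemma count_Up_Down: "motzkin_from h w \<Longrightarrow> h + count_list w Up = count_list w Down"
  by (induction w arbitrary: h) (fastforce split: step.splits)+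

text \<open>
  The argument \<open>i\<close> is the value that is processed next, and \<open>q\<close> holds the smaller values that are still
  to be written, front first.
\<close>

primrec queue_word :: "nat \<Rightarrow> nat list \<Rightarrow> step list \<Rightarrow> nat list" where
  "queue_word i q [] = []"
| "queue_word i q (s # w) =
     (case s of Up \<Rightarrow> queue_word (Suc i) (q @ [i]) w
      | Level \<Rightarrow> i # queue_word (Suc i) q w
      | Down \<Rightarrow> i # hd q # queue_word (Suc i) (tl q) w)"

text \<open>
  Words of blocks of one or two letters, read after a prefix: \<open>m\<close> bounds the first letters of
  the blocks of that prefix from above, and \<open>b\<close> is the last second letter that has occurred, or 0. A
  letter larger than its predecessor starts a new block.
\<close>

fun block_word :: "nat \<Rightarrow> nat \<Rightarrow> nat list \<Rightarrow> bool" where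
  "block_word m b [] \<longleftrightarrow> True"
| "block_word m b [x] \<longleftrightarrow> m < x"
| "block_word m b (x # y # v) \<longleftrightarrow>
     m < x \<and> (if x < y then block_word x b (y # v) else y < x \<and> b < y \<and> block_word x y v)"

lemma block_word_head: "block_word m b (x # v) \<Longrightarrow> m < x"
  by (cases v) auto

lemma block_word_singleton: "m < x \<Longrightarrow> block_word x b v \<Longrightarrow> block_word m b (x # v)"
  by (cases v) (auto dest: block_word_head)

text \<open>
  The bound \<open>m\<close> constrains only the first letter, because every later block is compared with the
  block before it.
\<close>

lemma block_word_change_head: "block_word m b (x # v) \<Longrightarrow> m' < x \<Longrightarrow> block_word m' b (x # v)"
  by (cases v) auto

lemma block_word_cases:
  assumes "block_word m b (x # v)"
  obtains "block_word x b v" | y v' where "v = y # v'" "y < x" "b < y" "block_word x y v'"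
  using assms by (cases v) (auto split: if_splits)

lemma block_word_values: "block_word m b v \<Longrightarrow> z \<in> set v \<Longrightarrow> m < z \<or> b < z"
  by (induction m b v rule: block_word.induct) (fastforce split: if_splits)+

text \<open>
  Every value is written exactly once: the queue is empty at the end because the path ends on the
  axis, and it is never read when empty because the path stays above the axis.
\<close>

lemma mset_queue_word:
  "motzkin_from (length q) w \<Longrightarrow>
     mset (queue_word i q w) = mset q + mset [i..<i + length w]"
proof (induction w arbitrary: i q)
  case (Cons s w)
  have e: "[i..<i + length (s # w)] = i # [Suc i..<Suc i + length w]"
    by (simp add: upt_conv_Cons del: upt_Suc)
  show ?case
  proof (cases s)
    case Down
    with Cons.prems obtain z q' where "q = z # q'" by (cases q) auto
    with Down Cons show ?thesis unfolding e by (simp del: mset_upt upt_Suc)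
  qed (use Cons e in \<open>simp_all del: mset_upt upt_Suc\<close>)
qed simp

text \<open>
  The first letters are the current values \<open>i\<close>, which increase. The second letters come out of a
  queue that is kept sorted since new values are larger than all earlier ones.
\<close>

lemma block_word_queue_word:
  "\<lbrakk>motzkin_from (length q) w; sorted_wrt (<) q; \<forall>z\<in>set q. b < z \<and> z < i; m < i; b < i\<rbrakk>
     \<Longrightarrow> block_word m b (queue_word i q w)"
proof (induction w arbitrary: i q m b)
  case (Cons s w)
  show ?case
  proof (cases s)
    case Up
    have "block_word m b (queue_word (Suc i) (q @ [i]) w)"
      using Cons.prems Up by (intro Cons.IH) (auto simp: sorted_wrt_append)
    then show ?thesis using Up by simp
  next
    case Level
    have "block_word i b (queue_word (Suc i) q w)"
      using Cons.prems Level by (intro Cons.IH) auto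
    then show ?thesis using Level Cons.prems by (simp add: block_word_singleton)
  next
    case Down
    with Cons.prems obtain z q' where q: "q = z # q'" by (cases q) auto
    have "block_word i z (queue_word (Suc i) q' w)"
      using Cons.prems Down q by (intro Cons.IH) auto
    then show ?thesis using Down q Cons.prems by auto
  qed
qed simp

text \<open>
  The beginning of the output determines the first step. After an up step everything that starts a
  block exceeds \<open>i\<close>, so the word does not start with \<open>i\<close>, as it does after the two other steps.
  These are distinguished by the letter after \<open>i\<close>: after a level step it starts a block, if it exists, and
  is larger than \<open>i\<close>, and it comes from the queue after a down step, so it is smaller.
\<close>

lemma queue_word_inj:
  "\<lbrakk>queue_word i q w = queue_word i q w'; length w = length w';
    motzkin_from (length q) w; motzkin_from (length q) w';
    sorted_wrt (<) q; \<forall>z\<in>set q. 0 < z \<and> z < i; 0 < i\<rbrakk> \<Longrightarrow> w = w'"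
proof (induction w arbitrary: i q w')
  case (Cons s w)
  from Cons.prems(2) obtain s' u where w': "w' = s' # u" by (cases w') auto
  have Up: "block_word i 0 (queue_word (Suc i) (q @ [i]) v)" if "motzkin_from (Suc (length q)) v" for v
    using Cons.prems that by (intro block_word_queue_word) (auto simp: sorted_wrt_append)
  have Level: "block_word i 0 (queue_word (Suc i) q v)" if "motzkin_from (length q) v" for v
    using Cons.prems that by (intro block_word_queue_word) auto
  have hd_q: "hd q < i" if "0 < length q"
    using Cons.prems that by (cases q) auto
  have IH: "w = u" if "queue_word (Suc i) p w = queue_word (Suc i) p u"
    "motzkin_from (length p) w" "motzkin_from (length p) u" "sorted_wrt (<) p"
    "\<forall>z\<in>set p. 0 < z \<and> z < Suc i" for p
    using Cons.IH[OF that(1) _ that(2-)] Cons.prems w' by simp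
  show ?case
  proof (cases s; cases s')
    assume s: "s = Up" "s' = Up"
    have "w = u"
      using Cons.prems s w' by (intro IH[of "q @ [i]"]) (auto simp: sorted_wrt_append)
    then show ?thesis using s w' by simp
  next
    assume s: "s = Level" "s' = Level"
    have "w = u"
      using Cons.prems s w' by (intro IH[of q]) auto
    then show ?thesis using s w' by simp
  next
    assume s: "s = Down" "s' = Down"
    have "w = u"
      using Cons.prems s w' by (intro IH[of "tl q"]) (cases q; auto)+
    then show ?thesis using s w' by simp
  next
    assume s: "s = Up" "s' = Level"
    then show ?thesis using Cons.prems w' Up[of w] by (auto dest: block_word_head)
  next
    assume s: "s = Up" "s' = Down"
    then show ?thesis using Cons.prems w' Up[of w] by (auto dest: block_word_head)
  next
    assume s: "s = Level" "s' = Up"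
    then have "block_word i 0 (queue_word i q (s # w))"
      unfolding Cons.prems(1) using Cons.prems(4) w' Up[of u] by simp
    then show ?thesis using s by (auto dest: block_word_head)
  next
    assume s: "s = Down" "s' = Up"
    then have "block_word i 0 (queue_word i q (s # w))"
      unfolding Cons.prems(1) using Cons.prems(4) w' Up[of u] by simp
    then show ?thesis using s by (auto dest: block_word_head)
  next
    assume s: "s = Level" "s' = Down"
    then have "queue_word (Suc i) q w = hd q # queue_word (Suc i) (tl q) u" "0 < length q"
      using Cons.prems w' by simp_all
    then have "i < hd q" "hd q < i"
      using Level[of w] hd_q Cons.prems(3) s by (simp_all add: block_word_head)
    then show ?thesis by simp
  next
    assume s: "s = Down" "s' = Level"
    then have "queue_word (Suc i) q u = hd q # queue_word (Suc i) (tl q) w" "0 < length q"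
      using Cons.prems w' by simp_all
    then have "i < hd q" "hd q < i"
      using Level[of u] hd_q Cons.prems(4) w' s by (simp_all add: block_word_head)
    then show ?thesis by simp
  qed
qed simp

text \<open>
  The value \<open>m + 1\<close> either starts the next block or has been passed over by the larger first letter,
  so that it can only be a second letter and is put into the queue. If \<open>m + 1\<close> starts a block of two
  letters, the second one comes from the queue, and it must be the front: a smaller queued value
  would have to occur later as a second letter, although the second letters increase.
\<close>

lemma queue_word_surj:
  "\<lbrakk>block_word m b v; distinct v; set v = set q \<union> {Suc m..m + k};
    sorted_wrt (<) q; \<forall>z\<in>set q. z \<le> m\<rbrakk>
     \<Longrightarrow> \<exists>w. length w = k \<and> motzkin_from (length q) w \<and> queue_word (Suc m) q w = v"
proof (induction k arbitrary: m b v q)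
  case 0
  have "v = []"
  proof (cases v)
    case (Cons x u)
    then have "m < x" "x \<in> set q"
      using 0(1,3) block_word_head by auto
    then show ?thesis using 0(5) by auto
  qed
  with 0 show ?case by simp
next
  case (Suc k)
  have "Suc m \<in> set v" using Suc.prems(3) by simp
  then obtain x v1 where v: "v = x # v1" by (cases v) auto
  have "m < x" using Suc.prems(1) v block_word_head by blast
  have range: "{Suc m..m + Suc k} = insert (Suc m) {Suc (Suc m)..Suc m + k}" by auto
  have notin: "Suc m \<notin> set q" using Suc.prems(5) by auto
  show ?case
  proof (cases "x = Suc m")
    case False
    have "\<exists>w. length w = k \<and> motzkin_from (length (q @ [Suc m])) w \<and>
              queue_word (Suc (Suc m)) (q @ [Suc m]) w = v"
    proof (rule Suc.IH)
      show "block_word (Suc m) b v"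
        using Suc.prems(1) v False \<open>m < x\<close> by (auto intro: block_word_change_head)
      show "set v = set (q @ [Suc m]) \<union> {Suc (Suc m)..Suc m + k}"
        using Suc.prems(3) range by auto
    qed (use Suc.prems in \<open>auto simp: sorted_wrt_append\<close>)
    then obtain w where "length w = k" "motzkin_from (Suc (length q)) w"
      "queue_word (Suc (Suc m)) (q @ [Suc m]) w = v" by auto
    then show ?thesis by (intro exI[of _ "Up # w"]) auto
  next
    case x: True
    have set_v1: "set v1 = set q \<union> {Suc (Suc m)..Suc m + k}"
    proof -
      have "set v1 = set v - {Suc m}" using Suc.prems(2) v x by auto
      then show ?thesis using Suc.prems(3) range notin by auto
    qed
    from Suc.prems(1)[unfolded v] show ?thesis
    proof (cases rule: block_word_cases)
      case 1
      have "\<exists>w. length w = k \<and> motzkin_from (length q) w \<and> queue_word (Suc (Suc m)) q w = v1"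
        by (rule Suc.IH[of _ b]) (use 1 x v set_v1 Suc.prems in auto)
      then obtain w where "length w = k" "motzkin_from (length q) w"
        "queue_word (Suc (Suc m)) q w = v1" by auto
      then show ?thesis using v x by (intro exI[of _ "Level # w"]) auto
    next
      case (2 y v2)
      have "y \<in> set v1" using 2(1) by simp
      then have "y \<in> set q" using set_v1 2(2) x by auto
      then obtain z q' where q: "q = z # q'" by (cases q) auto
      have "z = y"
      proof (rule ccontr)
        assume "z \<noteq> y"
        then have "z < y" "z \<in> set v2"
          using \<open>y \<in> set q\<close> q Suc.prems(4) set_v1 2 by auto
        then show False
          using block_word_values[OF 2(4)] Suc.prems(5) q x 2(2) by force
      qed
      have "\<exists>w. length w = k \<and> motzkin_from (length q') w \<and> queue_word (Suc (Suc m)) q' w = v2"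
      proof (rule Suc.IH)
        show "block_word (Suc m) y v2" using 2 x by simp
        have "set v2 = set v1 - {y}" using 2(1) v Suc.prems(2) by auto
        moreover have "y \<notin> set q'" using q \<open>z = y\<close> Suc.prems(4) by auto
        ultimately show "set v2 = set q' \<union> {Suc (Suc m)..Suc m + k}"
          using set_v1 q \<open>z = y\<close> 2(2) x by auto
      qed (use 2 v q Suc.prems in auto)
      then obtain w where "length w = k" "motzkin_from (length q') w"
        "queue_word (Suc (Suc m)) q' w = v2" by auto
      then show ?thesis using v x q \<open>z = y\<close> 2 by (intro exI[of _ "Down # w"]) auto
    qed
  qed
qed

definition fifo_words :: "nat \<Rightarrow> nat list set" where
  "fifo_words n = {v. distinct v \<and> set v = {1..n} \<and> block_word 0 0 v}"

lemma bij_betw_queue_word: "bij_betw (queue_word 1 []) (motzkin_paths n) (fifo_words n)"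
proof (rule bij_betw_imageI)
  show "inj_on (queue_word 1 []) (motzkin_paths n)"
    by (rule inj_onI, rule queue_word_inj) (auto simp: motzkin_paths_eq)
  have "queue_word 1 [] w \<in> fifo_words n" if w: "w \<in> motzkin_paths n" for w
  proof -
    have m: "mset (queue_word 1 [] w) = mset [1..<1 + n]"
      using mset_queue_word[of "[]" w 1] w by (auto simp: motzkin_paths_eq)
    have "distinct (queue_word 1 [] w)"
      using mset_eq_imp_distinct_iff[OF m] by simp
    moreover have "set (queue_word 1 [] w) = {1..n}"
      using mset_eq_setD[OF m] by auto
    moreover have "block_word 0 0 (queue_word 1 [] w)"
      using w by (intro block_word_queue_word) (auto simp: motzkin_paths_eq)
    ultimately show ?thesis by (simp add: fifo_words_def)
  qed
  moreover have "v \<in> queue_word 1 [] ` motzkin_paths n" if "v \<in> fifo_words n" for v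
    using queue_word_surj[of 0 0 v "[]" n] that by (auto simp: fifo_words_def motzkin_paths_eq)
  ultimately show "queue_word 1 [] ` motzkin_paths n = fifo_words n" by blast
qed

section \<open>Descents\<close>

definition descents :: "nat list \<Rightarrow> nat" where
  "descents v = length (filter (\<lambda>(x, y). y < x) (zip v (tl v)))"

text \<open>
  The only work here is the shift between positions that start at 0 and arguments that start at 1.
\<close>

lemma des_perm_of_word: "des (length v) (perm_of_word v) = descents v"
proof -
  define n where "n = length v"
  have "{i \<in> {1..<n}. perm_of_word v i > perm_of_word v (i + 1)} =
        Suc ` {i. i < length (zip v (tl v)) \<and> (case zip v (tl v) ! i of (x, y) \<Rightarrow> y < x)}"
  proof (intro set_eqI iffI)
    fix i assume "i \<in> {i \<in> {1..<n}. perm_of_word v i > perm_of_word v (i + 1)}"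
    then show "i \<in> Suc ` {i. i < length (zip v (tl v)) \<and> (case zip v (tl v) ! i of (x, y) \<Rightarrow> y < x)}"
      by (intro image_eqI[of _ _ "i - 1"]) (auto simp: n_def perm_of_word_def nth_tl)
  qed (auto simp: n_def perm_of_word_def nth_tl)
  then have "des n (perm_of_word v) =
      card {i. i < length (zip v (tl v)) \<and> (case zip v (tl v) ! i of (x, y) \<Rightarrow> y < x)}"
    by (simp add: des_def card_image)
  then show ?thesis by (simp add: descents_def length_filter_conv_card n_def)
qed

lemma descents_Cons_greater: "block_word x b v \<Longrightarrow> descents (x # v) = descents v"
  by (cases v) (auto simp: descents_def dest: block_word_head)

lemma descents_block: "block_word x y v \<Longrightarrow> y < x \<Longrightarrow> descents (x # y # v) = Suc (descents v)"
  by (cases v) (auto simp: descents_def dest: block_word_head)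

text \<open>
  A block is followed by a larger letter, so that descents occur only inside the blocks of two
  letters, and these are written by the down steps.
\<close>

lemma descents_queue_word:
  "\<lbrakk>motzkin_from (length q) w; sorted_wrt (<) q; \<forall>z\<in>set q. 0 < z \<and> z < i; 0 < i\<rbrakk>
     \<Longrightarrow> descents (queue_word i q w) = count_list w Down"
proof (induction w arbitrary: i q)
  case (Cons s w)
  show ?case
  proof (cases s)
    case Up
    have "descents (queue_word (Suc i) (q @ [i]) w) = count_list w Down"
      using Cons.prems Up by (intro Cons.IH) (auto simp: sorted_wrt_append)
    then show ?thesis using Up by simp
  next
    case Level
    have "descents (queue_word (Suc i) q w) = count_list w Down"
      using Cons.prems Level by (intro Cons.IH) auto
    moreover have "block_word i 0 (queue_word (Suc i) q w)"
      using Cons.prems Level by (intro block_word_queue_word) auto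
    ultimately show ?thesis using Level by (simp add: descents_Cons_greater)
  next
    case Down
    with Cons.prems obtain z q' where q: "q = z # q'" by (cases q) auto
    have "descents (queue_word (Suc i) q' w) = count_list w Down"
      using Cons.prems Down q by (intro Cons.IH) auto
    moreover have "block_word i z (queue_word (Suc i) q' w)"
      using Cons.prems Down q by (intro block_word_queue_word) auto
    ultimately show ?thesis using Down q Cons.prems by (simp add: descents_block)
  qed
qed (simp add: descents_def)

section \<open>Avoiding 321 and 3-12\<close>

definition has_321 :: "nat list \<Rightarrow> bool" where
  "has_321 v \<longleftrightarrow> (\<exists>a b c. subseq [a, b, c] v \<and> c < b \<and> b < a)"

text \<open>
  The vincular pattern 3-12: the letters playing 1 and 2 are adjacent, hence \<open>sublist\<close>, which asks
  for a contiguous factor.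
\<close>

definition has_3_12 :: "nat list \<Rightarrow> bool" where
  "has_3_12 v \<longleftrightarrow> (\<exists>us a ws p q. v = us @ a # ws \<and> sublist [p, q] ws \<and> p < q \<and> q < a)"

lemma has_321_Cons:
  "has_321 (x # v) \<longleftrightarrow> has_321 v \<or> (\<exists>b c. subseq [b, c] v \<and> c < b \<and> b < x)"
  (is "?L \<longleftrightarrow> ?R")
proof
  show "?L \<Longrightarrow> ?R"
    unfolding has_321_def by (auto split: if_splits)
  show "?R \<Longrightarrow> ?L"
    unfolding has_321_def by (meson list_emb_Cons subseq_Cons2)
qed

lemma has_3_12_Cons:
  "has_3_12 (x # v) \<longleftrightarrow> has_3_12 v \<or> (\<exists>p q. sublist [p, q] v \<and> p < q \<and> q < x)"
  (is "?L \<longleftrightarrow> ?R")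
proof
  show "?L \<Longrightarrow> ?R"
    unfolding has_3_12_def by (auto simp: Cons_eq_append_conv)
  show "?R \<Longrightarrow> ?L"
    unfolding has_3_12_def by (metis append_Cons append_Nil)
qed

lemma sublist_pair_Cons:
  "sublist [p, q] (x # v) \<longleftrightarrow> (p = x \<and> v \<noteq> [] \<and> hd v = q) \<or> sublist [p, q] v"
  by (cases v) (auto simp: sublist_Cons_right)

lemma sublist_pair_in: "sublist [p, q] v \<Longrightarrow> p \<in> set v \<and> q \<in> set v"
  by (auto simp: sublist_def)

lemma subseq_pair_in: "subseq [p, q] v \<Longrightarrow> p \<in> set v \<and> q \<in> set v"
  by (induction v) (auto simp: subseq_singleton_left split: if_splits)

text \<open>
  A letter followed immediately by a larger letter \<open>x\<close> cannot create a new occurrence of a pattern that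
  starts with its maximum, since \<open>x\<close> could play the same role. This serves to pass from one
  left-to-right maximum to the next.
\<close>

lemma no_321_Cons_less: "m < x \<Longrightarrow> \<not> has_321 (x # u) \<Longrightarrow> \<not> has_321 (m # x # u)"
  using less_trans by (fastforce simp: has_321_Cons split: if_splits)

lemma no_3_12_Cons_less: "m < x \<Longrightarrow> \<not> has_3_12 (x # u) \<Longrightarrow> \<not> has_3_12 (m # x # u)"
  using less_trans by (fastforce simp: has_3_12_Cons sublist_pair_Cons)

text \<open>
  The bound \<open>m\<close> is put in front of the word as a representative of the earlier maxima, which makes the
  claim strong enough for induction. A second letter \<open>y\<close> is smaller than everything after it, so it
  starts neither pattern and is not the middle of 321; nor is it the end of 321, because the first
  letter of its block exceeds everything before. Its right neighbour starts a new block, hence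
  exceeds everything before, so \<open>y\<close> is not the 1 of 3-12.
\<close>

lemma block_word_imp_avoids:
  "block_word m b v \<Longrightarrow> b \<le> m \<Longrightarrow> \<not> has_321 (m # v) \<and> \<not> has_3_12 (m # v)"
proof (induction m b v rule: block_word.induct)
  case (1 m b)
  then show ?case by (auto simp: has_321_def has_3_12_Cons) (auto simp: has_3_12_def)
next
  case (2 m b x)
  then show ?case by (auto simp: has_321_Cons has_3_12_Cons sublist_pair_Cons split: if_splits)
     (auto simp: has_321_def has_3_12_def)
next
  case (3 m b x y v)
  then have "m < x" by simp
  have "\<not> has_321 (x # y # v) \<and> \<not> has_3_12 (x # y # v)"
  proof (cases "x < y")
    case True
    then show ?thesis using 3 by simp
  next
    case False
    with 3 have y: "y < x" and v: "block_word x y v"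
      and IH: "\<not> has_321 (x # v)" "\<not> has_3_12 (x # v)" by auto
    have large: "y < z" if "z \<in> set v" for z
      using block_word_values[OF v that] y by auto
    then have not_small: "\<forall>z\<in>set v. \<not> z < y" by (simp add: less_imp_not_less)
    have "\<not> has_321 (y # v)"
      using IH(1) not_small by (auto simp: has_321_Cons dest!: subseq_pair_in)
    moreover have "\<not> (\<exists>p q. subseq [p, q] (y # v) \<and> q < p \<and> p < x)"
    proof (intro notI, elim exE conjE)
      fix p q assume pq: "subseq [p, q] (y # v)" "q < p" "p < x"
      show False
      proof (cases "p = y")
        case True
        then show False using pq large[of q] by (simp add: subseq_singleton_left)
      next
        case False
        then show False using pq IH(1) unfolding has_321_Cons by auto
      qed
    qed
    moreover have "\<not> has_3_12 (y # v)"
      using IH(2) not_small by (auto simp: has_3_12_Cons dest!: sublist_pair_in)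
    moreover have "\<not> (\<exists>p q. sublist [p, q] (y # v) \<and> p < q \<and> q < x)"
      using IH(2) v by (cases v) (auto simp: has_3_12_Cons sublist_pair_Cons dest: block_word_head)
    ultimately show ?thesis
      by (simp add: has_321_Cons[of x] has_3_12_Cons[of x] del: subseq_Cons2_iff)
  qed
  then show ?case
    using no_321_Cons_less no_3_12_Cons_less \<open>m < x\<close> by blast
qed

text \<open>
  After a descent \<open>x > y\<close> every later letter exceeds \<open>y\<close>, or 321 would occur; so the next letter
  \<open>z\<close> exceeds \<open>y\<close>, and it must even exceed \<open>x\<close>, or \<open>x\<close>, \<open>y\<close>, \<open>z\<close> would form 3-12.
\<close>

lemma avoids_imp_block_word:
  "\<lbrakk>distinct v; \<not> has_321 v; \<not> has_3_12 v; v = [] \<or> m < hd v; \<forall>z\<in>set v. b < z\<rbrakk>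
     \<Longrightarrow> block_word m b v"
proof (induction m b v rule: block_word.induct)
  case (3 m b x y v)
  have no: "\<not> has_321 (y # v)" "\<not> has_3_12 (y # v)" "\<not> has_321 v" "\<not> has_3_12 v"
    using 3(4,5) by (auto simp: has_321_Cons has_3_12_Cons)
  show ?case
  proof (cases "x < y")
    case True
    then show ?thesis using 3 no by simp
  next
    case False
    with 3(3) have "y < x" by simp
    have large: "y < z" if z: "z \<in> set v" for z
    proof (rule ccontr)
      assume "\<not> y < z"
      with z 3(3) have "z < y" by (cases "z = y") auto
      moreover have "subseq [y, z] (y # v)" using z by (simp add: subseq_singleton_left)
      ultimately show False using 3(4) \<open>y < x\<close> has_321_Cons by blast
    qed
    have "v = [] \<or> x < hd v"
    proof (rule ccontr)
      assume "\<not> ?thesis"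
      then have "v \<noteq> []" "hd v < x" "y < hd v"
        using 3(3) large by (cases v; auto)+
      moreover from this have "sublist [y, hd v] (y # v)"
        by (simp add: sublist_pair_Cons)
      ultimately show False using 3(5) has_3_12_Cons by blast
    qed
    then have "block_word x y v"
      using 3 False no large by simp
    then show ?thesis using 3 False \<open>y < x\<close> by simp
  qed
qed auto

lemma fifo_words_eq:
  "fifo_words n = {v. distinct v \<and> set v = {1..n} \<and> \<not> has_321 v \<and> \<not> has_3_12 v}"
proof -
  have "block_word 0 0 v \<longleftrightarrow> \<not> has_321 v \<and> \<not> has_3_12 v"
    if "distinct v" "set v = {1..n}" for v
  proof
    assume "block_word 0 0 v"
    from block_word_imp_avoids[OF this] show "\<not> has_321 v \<and> \<not> has_3_12 v"
      by (simp add: has_321_Cons has_3_12_Cons)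
  next
    assume "\<not> has_321 v \<and> \<not> has_3_12 v"
    moreover have "v = [] \<or> 0 < hd v"
    proof (cases v)
      case (Cons x u)
      then have "x \<in> {1..n}" unfolding that(2)[symmetric] by simp
      then show ?thesis using Cons by simp
    qed simp
    ultimately show "block_word 0 0 v"
      using that by (intro avoids_imp_block_word) auto
  qed
  then show ?thesis by (auto simp: fifo_words_def)
qed

section \<open>One-line notation\<close>

lemma perm_of_word_one_line:
  assumes "\<sigma> \<in> perms n"
  shows "perm_of_word (one_line n \<sigma>) = \<sigma>"
proof
  fix i
  show "perm_of_word (one_line n \<sigma>) i = \<sigma> i"
    using assms permutes_not_in[of \<sigma> "{1..n}" i]
    by (auto simp: perm_of_word_def one_line_def perms_def nth_append simp del: upt_Suc)
qed

lemma one_line_perm_of_word: "length v = n \<Longrightarrow> one_line n (perm_of_word v) = v"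
  by (intro nth_equalityI) (auto simp: perm_of_word_def one_line_def simp del: upt_Suc)

lemma one_line_perms:
  assumes "\<sigma> \<in> perms n"
  shows "distinct (one_line n \<sigma>)" "set (one_line n \<sigma>) = {1..n}"
proof -
  have "\<sigma> permutes {1..n}" using assms by (simp add: perms_def)
  moreover have "set [1..<Suc n] = {1..n}" by auto
  ultimately show "distinct (one_line n \<sigma>)" "set (one_line n \<sigma>) = {1..n}"
    unfolding one_line_def distinct_map set_map
    by (auto simp: permutes_inj_on permutes_image simp del: upt_Suc)
qed

lemma perm_of_word_in_perms:
  assumes "distinct v" "set v = {1..n}"
  shows "perm_of_word v \<in> perms n"
proof -
  have len: "length v = n" using distinct_card[OF assms(1)] assms(2) by simp
  have "bij_betw (\<lambda>i. v ! (i - 1)) {1..n} {1..n}"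
  proof (rule bij_betw_trans[of "\<lambda>i. i - 1" _ "{..<n}" "(!) v" "{1..n}", unfolded comp_def])
    show "bij_betw (\<lambda>i. i - 1) {1..n} {..<n}"
      by (rule bij_betw_byWitness[of _ Suc]) auto
    show "bij_betw ((!) v) {..<n} {1..n}"
      using bij_betw_nth[OF assms(1)] len assms(2) by simp
  qed
  also have "bij_betw (\<lambda>i. v ! (i - 1)) {1..n} {1..n} \<longleftrightarrow> bij_betw (perm_of_word v) {1..n} {1..n}"
    by (rule bij_betw_cong) (simp add: perm_of_word_def len)
  finally have "bij_betw (perm_of_word v) {1..n} {1..n}" .
  then show ?thesis
    unfolding perms_def mem_Collect_eq
    by (rule bij_imp_permutes) (auto simp: perm_of_word_def len)
qed

lemma contains_classical_321_iff:
  "contains_classical n \<sigma> [3, 2, 1] \<longleftrightarrow> has_321 (one_line n \<sigma>)"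
proof -
  have "order_isomorphic u [3, 2, 1] \<longleftrightarrow> (\<exists>a b c. u = [a, b, c] \<and> c < b \<and> b < a)" for u
  proof
    assume u: "order_isomorphic u [3, 2, 1]"
    then obtain a b c where e: "u = [a, b, c]"
      by (auto simp: order_isomorphic_def length_Suc_conv)
    with u show "\<exists>a b c. u = [a, b, c] \<and> c < b \<and> b < a"
      by (auto simp: order_isomorphic_def All_less_Suc numeral_3_eq_3)
  next
    assume "\<exists>a b c. u = [a, b, c] \<and> c < b \<and> b < a"
    then show "order_isomorphic u [3, 2, 1]"
      by (elim exE) (simp add: order_isomorphic_def All_less_Suc)
  qed
  then show ?thesis by (auto simp: contains_classical_def has_321_def)
qed

section \<open>Standard cycle notation\<close>

lemma support_eq_Cons:
  assumes "permutation p"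
  obtains c where "support p a = a # c"
  using least_power_of_permutation(2)[OF assms, of a]
  by (auto simp: upt_conv_Cons)

text \<open>
  The case of an empty \<open>c2\<close> is the step from the last entry back to the starting point of the cycle.
\<close>

lemma support_successor:
  assumes "permutation p" "support p a = c1 @ x # c2"
  shows "p x = (if c2 = [] then a else hd c2)"
proof -
  define i where "i = length c1"
  have len: "least_power p a = Suc (i + length c2)"
    using arg_cong[OF assms(2), of length] by (simp add: i_def)
  have nth: "(c1 @ x # c2) ! k = (p ^^ k) a" if "k \<le> i + length c2" for k
    unfolding assms(2)[symmetric] using that len by (simp del: upt_Suc)
  have "x = (p ^^ i) a"
    using nth[of i] by (simp add: i_def)
  then have px: "p x = (p ^^ Suc i) a" by simp
  show ?thesis
  proof (cases c2)
    case Nil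
    then show ?thesis
      using px least_power_of_permutation(1)[OF assms(1), of a] len by simp
  next
    case (Cons y c)
    then show ?thesis using px nth[of "Suc i"] by (simp add: i_def nth_append)
  qed
qed

lemma finite_cycle_maxima: "finite (cycle_maxima n \<sigma>)"
  by (simp add: cycle_maxima_def)

lemma perms_permutation: "\<sigma> \<in> perms n \<Longrightarrow> permutation \<sigma>"
  by (auto simp: perms_def permutation_permutes)

lemma support_subset:
  assumes "\<sigma> \<in> perms n" "a \<in> {1..n}"
  shows "set (support \<sigma> a) \<subseteq> {1..n}"
  using assms permutes_in_image[OF permutes_funpow[of \<sigma> "{1..n}"]] by (auto simp: perms_def)

lemma in_standard_cycles_iff:
  "x \<in> set (concat (standard_cycles n \<sigma>)) \<longleftrightarrow> (\<exists>a\<in>cycle_maxima n \<sigma>. x \<in> set (support \<sigma> a))"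
proof -
  have "x \<in> set (concat (map S ms)) \<longleftrightarrow> (\<exists>a\<in>set ms. x \<in> set (S a))" for S :: "nat \<Rightarrow> nat list" and ms
    by simp
  then show ?thesis
    unfolding standard_cycles_def by (simp only: set_sorted_list_of_set[OF finite_cycle_maxima])
qed

text \<open>
  Distinct cycle maxima have disjoint cycles, since a cycle has only one maximum; and every
  \<open>x\<close> is found in the cycle of the maximum of its own cycle.
\<close>

lemma standard_cycles_word:
  assumes "\<sigma> \<in> perms n"
  shows "distinct (concat (standard_cycles n \<sigma>))" "set (concat (standard_cycles n \<sigma>)) = {1..n}"
proof -
  note perm = perms_permutation[OF assms]
  have self: "a \<in> set (support \<sigma> a)" for a
    by (rule support_eq_Cons[OF perm, of a]) (metis list.set_intros(1))
  have same: "set (support \<sigma> a) = set (support \<sigma> b)" if "a \<in> set (support \<sigma> b)" for a b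
    using disjoint_support[OF perm] self[of a] that unfolding disjoint_def by blast
  have max_eq: "a = b" if "a \<in> cycle_maxima n \<sigma>" "b \<in> cycle_maxima n \<sigma>"
    "set (support \<sigma> a) \<inter> set (support \<sigma> b) \<noteq> {}" for a b
    using that same unfolding cycle_maxima_def mem_Collect_eq
    by (metis disjoint_support'[OF perm])
  define ms where "ms = sorted_list_of_set (cycle_maxima n \<sigma>)"
  have ms: "set ms = cycle_maxima n \<sigma>" "distinct ms"
    using finite_cycle_maxima by (simp_all add: ms_def)
  have "distinct (map (support \<sigma>) ms)"
    unfolding distinct_map
  proof (intro conjI inj_onI)
    fix a b assume "a \<in> set ms" "b \<in> set ms" "support \<sigma> a = support \<sigma> b"
    then show "a = b" using max_eq[of a b] self[of a] ms(1) by auto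
  qed (rule ms(2))
  then have "distinct (concat (map (support \<sigma>) ms))"
  proof (rule distinct_concat)
    fix ys assume "ys \<in> set (map (support \<sigma>) ms)"
    then show "distinct ys" using cycle_of_permutation[OF perm] by (auto simp del: set_upt)
  next
    fix ys zs assume "ys \<in> set (map (support \<sigma>) ms)" "zs \<in> set (map (support \<sigma>) ms)" "ys \<noteq> zs"
    then obtain a b where "ys = support \<sigma> a" "zs = support \<sigma> b" "a \<in> cycle_maxima n \<sigma>"
      "b \<in> cycle_maxima n \<sigma>" "a \<noteq> b" unfolding set_map ms(1) by blast
    then show "set ys \<inter> set zs = {}" using max_eq by blast
  qed
  then show "distinct (concat (standard_cycles n \<sigma>))"
    by (simp add: standard_cycles_def ms_def)
  show "set (concat (standard_cycles n \<sigma>)) = {1..n}"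
  proof
    have "cycle_maxima n \<sigma> \<subseteq> {1..n}" by (auto simp: cycle_maxima_def)
    then show "set (concat (standard_cycles n \<sigma>)) \<subseteq> {1..n}"
      using support_subset[OF assms] in_standard_cycles_iff by (meson subset_iff)
    show "{1..n} \<subseteq> set (concat (standard_cycles n \<sigma>))"
    proof
      fix x assume x: "x \<in> {1..n}"
      define a where "a = Max (set (support \<sigma> x))"
      have a: "a \<in> set (support \<sigma> x)"
        unfolding a_def by (rule Max_in[OF finite_set]) (metis empty_iff self)
      have s: "set (support \<sigma> a) = set (support \<sigma> x)" by (rule same[OF a])
      have "a \<in> {1..n}" using a support_subset[OF assms x] by blast
      then have "a \<in> cycle_maxima n \<sigma>"
        unfolding cycle_maxima_def mem_Collect_eq s by (simp add: a_def)
      moreover have "x \<in> set (support \<sigma> a)" using self[of x] s by blast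
      ultimately show "x \<in> set (concat (standard_cycles n \<sigma>))"
        unfolding in_standard_cycles_iff by (rule bexI[rotated])
    qed
  qed
qed

text \<open>
  Inside a block the next letter is smaller than the first letter of the block. At the end of a
  block the next letter, if there is one, starts a new block and exceeds everything before it, while
  the maximum of the letters so far is the first letter of the block just completed. So the
  successor of \<open>x\<close> in its cycle can be read off from the word without knowing the blocks.
\<close>

lemma concat_blocks_successor:
  fixes S :: "nat \<Rightarrow> nat list"
  assumes "sorted_wrt (<) ms" and distinct: "distinct (us @ x # ws)"
    and concat: "concat (map S ms) = us @ x # ws"
    and head: "\<And>d. d \<in> set ms \<Longrightarrow> \<exists>r. S d = d # r"
    and max: "\<And>d z. d \<in> set ms \<Longrightarrow> z \<in> set (S d) \<Longrightarrow> z \<le> d"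
    and succ: "\<And>d c1 c2. d \<in> set ms \<Longrightarrow> S d = c1 @ x # c2 \<Longrightarrow> \<sigma> x = (if c2 = [] then d else hd c2)"
  shows "\<sigma> x = (if ws \<noteq> [] \<and> (\<exists>a\<in>set (us @ [x]). hd ws < a) then hd ws else Max (set (us @ [x])))"
proof -
  have "x \<in> set (concat (map S ms))" unfolding concat by simp
  then obtain a where a: "a \<in> set ms" "x \<in> set (S a)" by auto
  then obtain as bs where split: "ms = as @ a # bs" by (meson split_list)
  obtain c1 c2 where c: "S a = c1 @ x # c2" using a(2) by (meson split_list)
  let ?U = "concat (map S as) @ c1" and ?W = "c2 @ concat (map S bs)"
  have "us @ x # ws = ?U @ x # ?W"
    unfolding concat[symmetric] split by (simp add: c)
  moreover have "x \<notin> set us" "x \<notin> set ws" using distinct by auto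
  ultimately have us: "us = ?U" and ws: "ws = ?W"
    using append_Cons_eq_iff[of x us ws ?U ?W] by blast+
  have le: "z \<le> a" if z: "z \<in> set (us @ [x])" for z
  proof -
    consider d where "d \<in> set as" "z \<in> set (S d)" | "z \<in> set (S a)"
      using z unfolding us c by auto
    then show ?thesis
    proof cases
      case 1
      then have "z \<le> d" "d < a" using max[of d z] split assms(1) by (auto simp: sorted_wrt_append)
      then show ?thesis by simp
    next
      case 2
      then show ?thesis using max a(1) by simp
    qed
  qed
  have a_in: "a \<in> set (us @ [x])"
    using head[OF a(1)] unfolding us c by (cases c1) auto
  have Max: "Max (set (us @ [x])) = a"
    by (rule Max_eqI) (use le a_in in auto)
  show ?thesis
  proof (cases c2)
    case (Cons y r)
    have "a \<noteq> y" using distinct a_in ws Cons by auto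
    moreover have "y \<le> a" using max[OF a(1), of y] c Cons by simp
    ultimately have "\<exists>d\<in>set (us @ [x]). hd ws < d"
      using a_in ws Cons by (intro bexI[of _ a]) auto
    then show ?thesis using succ[OF a(1) c] ws Cons by simp
  next
    case Nil
    have "\<not> (\<exists>d\<in>set (us @ [x]). hd ws < d)" if "ws \<noteq> []"
    proof -
      from that ws Nil obtain d ds where bs: "bs = d # ds" by (cases bs) auto
      moreover obtain r where "S d = d # r" using head[of d] split bs by auto
      ultimately have "hd ws = d" using ws Nil by simp
      moreover have "a < d" using assms(1) split bs by (simp add: sorted_wrt_append)
      ultimately show ?thesis using le by fastforce
    qed
    then show ?thesis using succ[OF a(1) c] Nil Max by auto
  qed
qed

lemma standard_cycles_successor:
  assumes "\<sigma> \<in> perms n" "concat (standard_cycles n \<sigma>) = us @ x # ws"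
  shows "\<sigma> x = (if ws \<noteq> [] \<and> (\<exists>a\<in>set (us @ [x]). hd ws < a) then hd ws else Max (set (us @ [x])))"
proof (rule concat_blocks_successor[where S = "support \<sigma>" and \<sigma> = \<sigma>
    and ms = "sorted_list_of_set (cycle_maxima n \<sigma>)"])
  note perm = perms_permutation[OF assms(1)]
  let ?ms = "sorted_list_of_set (cycle_maxima n \<sigma>)"
  have ms: "set ?ms = cycle_maxima n \<sigma>"
    using finite_cycle_maxima by simp
  show "sorted_wrt (<) ?ms" by simp
  show "distinct (us @ x # ws)"
    using standard_cycles_word(1)[OF assms(1)] unfolding assms(2) .
  show "concat (map (support \<sigma>) ?ms) = us @ x # ws"
    using assms(2) unfolding standard_cycles_def .
  show "\<exists>r. support \<sigma> d = d # r" for d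
    by (rule support_eq_Cons[OF perm, of d]) (erule exI)
  show "z \<le> d" if "d \<in> set ?ms" "z \<in> set (support \<sigma> d)" for d z
  proof -
    have "d \<in> cycle_maxima n \<sigma>" using that(1) unfolding ms .
    then have "d = Max (set (support \<sigma> d))" unfolding cycle_maxima_def by blast
    then show ?thesis using Max_ge[OF finite_set that(2)] by simp
  qed
  show "\<sigma> x = (if c2 = [] then d else hd c2)" if "support \<sigma> d = c1 @ x # c2" for d c1 c2
    by (rule support_successor[OF perm that])
qed

lemma one_line_Phi:
  assumes "\<sigma> \<in> perms n"
  shows "one_line n (Phi n \<sigma>) = concat (standard_cycles n \<sigma>)"
proof -
  have "length (concat (standard_cycles n \<sigma>)) = n"
    using distinct_card[OF standard_cycles_word(1)[OF assms]] standard_cycles_word(2)[OF assms] by simp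
  then show ?thesis unfolding Phi_def by (rule one_line_perm_of_word)
qed

text \<open>
  The word determines the successor of every letter.
\<close>

lemma inj_on_Phi: "inj_on (Phi n) (perms n)"
proof (rule inj_onI)
  fix \<sigma> \<tau> assume p: "\<sigma> \<in> perms n" "\<tau> \<in> perms n" and "Phi n \<sigma> = Phi n \<tau>"
  then have eq: "concat (standard_cycles n \<sigma>) = concat (standard_cycles n \<tau>)"
    using one_line_Phi by metis
  show "\<sigma> = \<tau>"
  proof
    fix x
    show "\<sigma> x = \<tau> x"
    proof (cases "x \<in> {1..n}")
      case True
      then have "x \<in> set (concat (standard_cycles n \<sigma>))"
        unfolding standard_cycles_word(2)[OF p(1)] .
      then obtain us ws where u: "concat (standard_cycles n \<sigma>) = us @ x # ws"
        by (meson split_list)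
      show ?thesis
        unfolding standard_cycles_successor[OF p(1) u]
          standard_cycles_successor[OF p(2) u[unfolded eq]] ..
    next
      case False
      then show ?thesis using p permutes_not_in unfolding perms_def by (metis mem_Collect_eq)
    qed
  qed
qed

text \<open>
  An injective map of a finite set to itself is surjective, so that \<open>hat\<close> is a genuine preimage.
\<close>

lemma Phi_image: "Phi n ` perms n = perms n"
proof (rule endo_inj_surj)
  show "finite (perms n)" by (simp add: perms_def finite_permutations)
  show "Phi n ` perms n \<subseteq> perms n"
    unfolding Phi_def by (intro image_subsetI perm_of_word_in_perms standard_cycles_word)
qed (rule inj_on_Phi)

lemma hat_successor:
  assumes "\<sigma> \<in> perms n" "one_line n \<sigma> = us @ x # ws"
  shows "hat n \<sigma> x =
    (if ws \<noteq> [] \<and> (\<exists>a\<in>set (us @ [x]). hd ws < a) then hd ws else Max (set (us @ [x])))"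
proof (rule standard_cycles_successor[where \<sigma> = "hat n \<sigma>"])
  have s: "\<sigma> \<in> Phi n ` perms n" using assms(1) Phi_image by simp
  show h: "hat n \<sigma> \<in> perms n" unfolding hat_def by (rule inv_into_into[OF s])
  have "Phi n (hat n \<sigma>) = \<sigma>" unfolding hat_def by (rule f_inv_into_f[OF s])
  then show "concat (standard_cycles n (hat n \<sigma>)) = us @ x # ws"
    using one_line_Phi[OF h] assms(2) by simp
qed

text \<open>
  If \<open>hat\<close> sends \<open>x1\<close> to a letter further to the right, it is the next letter and lies below an
  earlier one. This earlier letter is not \<open>x1\<close> itself since \<open>x1 < x2\<close>.
\<close>

lemma contains_beta_iff:
  assumes "\<sigma> \<in> perms n"
  shows "contains_arrow n \<sigma> beta \<longleftrightarrow> has_3_12 (one_line n \<sigma>)"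
proof
  assume "contains_arrow n \<sigma> beta"
  then obtain x1 x2 where x: "x1 < x2" "subseq [x1, x2] (one_line n \<sigma>)" "hat n \<sigma> x1 = x2"
    unfolding contains_arrow_beta_iff by blast
  from list_emb_ConsD[OF x(2)] obtain us ws where v: "one_line n \<sigma> = us @ x1 # ws" "x2 \<in> set ws"
    by (auto simp: subseq_singleton_left)
  have "x2 \<notin> set (us @ [x1])"
    using one_line_perms(1)[OF assms] v by auto
  then have "x2 \<noteq> Max (set (us @ [x1]))"
    using Max_in[of "set (us @ [x1])"] by (metis Nil_is_append_conv finite_set list.distinct(1) set_empty)
  with hat_successor[OF assms v(1)] x(3)
  obtain a where a: "a \<in> set (us @ [x1])" "ws \<noteq> []" "hd ws = x2" "x2 < a"
    by (metis (lifting))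
  with x(1) have "a \<in> set us" by auto
  then obtain u1 u2 where "us = u1 @ a # u2" by (meson split_list)
  moreover have "sublist [x1, x2] (u2 @ x1 # ws)"
    unfolding sublist_def using a by (intro exI[of _ u2] exI[of _ "tl ws"]) (cases ws; simp)
  ultimately show "has_3_12 (one_line n \<sigma>)"
    unfolding has_3_12_def using v(1) x(1) a(4) by (metis append.assoc append_Cons)
next
  assume "has_3_12 (one_line n \<sigma>)"
  then obtain us a w1 w2 p q where v: "one_line n \<sigma> = us @ a # w1 @ [p, q] @ w2" "p < q" "q < a"
    unfolding has_3_12_def sublist_def by blast
  have v': "one_line n \<sigma> = (us @ a # w1) @ p # q # w2" using v by simp
  have "hat n \<sigma> p = q"
    unfolding hat_successor[OF assms v'] using v(3) by auto
  moreover have "subseq [p, q] (one_line n \<sigma>)"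
    unfolding v' by (intro list_emb_append2) simp
  moreover have "p \<in> {1..n}" "q \<in> {1..n}"
    unfolding one_line_perms(2)[OF assms, symmetric] v' by auto
  ultimately show "contains_arrow n \<sigma> beta"
    unfolding contains_arrow_beta_iff using v(2) by blast
qed

lemma bij_betw_perm_of_word: "bij_betw perm_of_word (fifo_words n) (Av_321_beta n)"
proof (rule bij_betw_byWitness[where f' = "one_line n"])
  have len: "length v = n" if "v \<in> fifo_words n" for v
    using that distinct_card[of v] by (simp add: fifo_words_def)
  then show "\<forall>v\<in>fifo_words n. one_line n (perm_of_word v) = v"
    by (simp add: one_line_perm_of_word)
  show "\<forall>\<sigma>\<in>Av_321_beta n. perm_of_word (one_line n \<sigma>) = \<sigma>"
    by (simp add: Av_321_beta_def perm_of_word_one_line)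
  show "perm_of_word ` fifo_words n \<subseteq> Av_321_beta n"
  proof
    fix \<sigma> assume "\<sigma> \<in> perm_of_word ` fifo_words n"
    then obtain v where v: "\<sigma> = perm_of_word v" "v \<in> fifo_words n" by blast
    then have "\<sigma> \<in> perms n" by (simp add: perm_of_word_in_perms fifo_words_def)
    then show "\<sigma> \<in> Av_321_beta n"
      using v len[OF v(2)]
      by (simp add: Av_321_beta_def contains_classical_321_iff contains_beta_iff fifo_words_eq
          one_line_perm_of_word del: One_nat_def)
  qed
  show "one_line n ` Av_321_beta n \<subseteq> fifo_words n"
    by (auto simp: Av_321_beta_def contains_classical_321_iff contains_beta_iff fifo_words_eq
        one_line_perms simp del: atLeastAtMost_iff One_nat_def)
qed

theorem theorem4p4:
  shows "(\<forall>n\<ge>1. \<exists>\<psi> :: step list \<Rightarrow> (nat \<Rightarrow> nat).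
            bij_betw \<psi> (motzkin_paths n) (Av_321_beta n) \<and>
            (\<forall>w \<in> motzkin_paths n. nu w = des n (\<psi> w))) \<and>
         (\<forall>n\<ge>2. card (Av_321_beta n) = motzkin_number n)"
proof -
  define \<psi> where "\<psi> = perm_of_word \<circ> queue_word 1 []"
  have bij: "bij_betw \<psi> (motzkin_paths n) (Av_321_beta n)" for n
    unfolding \<psi>_def by (rule bij_betw_trans[OF bij_betw_queue_word bij_betw_perm_of_word])
  moreover have "nu w = des n (\<psi> w)" if w: "w \<in> motzkin_paths n" for n w
  proof -
    have m: "motzkin_from 0 w" using w by (simp add: motzkin_paths_eq)
    have "queue_word 1 [] w \<in> fifo_words n"
      using bij_betw_queue_word w by (rule bij_betwE[THEN bspec])
    then have "length (queue_word 1 [] w) = n"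
      using distinct_card[of "queue_word 1 [] w"] by (simp add: fifo_words_def)
    then have "des n (\<psi> w) = descents (queue_word 1 [] w)"
      using des_perm_of_word by (auto simp: \<psi>_def)
    also have "\<dots> = count_list w Down"
      using m by (intro descents_queue_word) auto
    also have "\<dots> = nu w"
      using count_Up_Down[OF m] by (simp add: nu_def)
    finally show ?thesis by simp
  qed
  moreover have "card (Av_321_beta n) = motzkin_number n" for n
    using bij_betw_same_card[OF bij] by (simp add: motzkin_number_def)
  ultimately show ?thesis by blast
qed

end
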